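(* Let $\{R^c:c\in C\}$ be a consistently connected system, i.e. $R^c_p\sim R^{c'}_p$ for all $p\in P$ and all $c,c'\in C_p$. Then the following two measures of contextuality agree: (a) the minimum negative probability mass over all negative probability joints of $\{Q_p:p\in P\}$ such that (1) for every $c\in C$ the marginal distribution of the subset $Q^c=\{Q_p:p\in P^c\}$ is a proper (nonnegative) probability distribution, and (2) there exist couplings $(\hat R^c,\hat Q^c)$ of $(R^c,Q^c)$, for every $c\in C$, satisfying $\Delta=\Delta_0$; (b) the NP measure of contextuality, i.e. the minimum negative probability mass over all negative probability joints of $\{Q_p:p\in P\}$ such that $\{Q_p:p\in P^c\}\sim R^c$ for every $c\in C$.
   Context: Setting. $P$ is a finite set of properties and $C$ a finite set of contexts. For each $c\in C$, $P^c\subset P$ is the set of properties that enter in context $c$, and for each $p\in P$, $C_p=\{c\in C: p\in P^c\}$. For each $c\in C$, the bunch $R^c=\{R^c_p:p\in P^c\}$ is a set of jointly distributed random variables $R^c_p:\Omega_c\to E_p$, with values in arbitrary (measurable) spaces $E_p$ for which events of the form $\{X\ne Y\}$ are measurable. Different bunches need not be defined on a common probability space. $X\sim Y$ means that $X$ and $Y$ have the same distribution. A coupling of $X_1,\dots,X_n$ (possibly defined on different probability spaces) is any jointly distributed $(\hat X_1,\dots,\hat X_n)$ with $\hat X_i\sim X_i$ for all $i$. A negative probability joint of $\{Q_p:p\in P\}$ is a signed distribution (finite signed measure) of total mass $1$ on $\prod_{p\in P}E_p$; for finite $E_p$ it is a real-valued function on $\prod_p E_p$ summing to $1$. Its negative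 probability mass is the total mass of its negative part (for finite $E_p$: the sum of $\max\{0,-q\}$ over its values $q$). Marginals are defined as for ordinary distributions; the marginal on $\prod_{p\in P^c}E_p$ is the distribution of $Q^c=\{Q_p:p\in P^c\}$, whose elements are indexed as $Q^c_p=Q_p$. When it is a proper probability distribution, $Q^c$ is treated as an ordinary random vector. For couplings $(\hat R^c,\hat Q^c)$ of $(R^c,Q^c)$, $c\in C$, chosen separately for each $c$, $$\Delta=\sum_{p\in P}\sum_{c\in C_p}\Pr[\hat Q^c_p\ne\hat R^c_p],$$ and $$\Delta_0=\sum_{p\in P}\Delta_p,\qquad \Delta_p=\min_{\text{all choices of }Q_p}\ \sum_{c\in C_p}\ \min_{\text{all couplings }(T_p,S_p)\text{ of }(Q_p,R^c_p)}\Pr[T_p\ne S_p],$$ where in $\Delta_p$ the outer minimum is over (proper) random variables $Q_p$ with values in $E_p$. Minimum values of negative probability mass are read as infima if not attained. *)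

theory Defs
  imports "HOL-Probability.Probability"
begin

definition signed_measure :: "'a measure \<Rightarrow> ('a set \<Rightarrow> real) \<Rightarrow> bool" where
  "signed_measure M \<mu> \<longleftrightarrow> \<mu> {} = 0 \<and>
     (\<forall>A :: nat \<Rightarrow> 'a set. range A \<subseteq> sets M \<longrightarrow> disjoint_family A \<longrightarrow>
        (\<lambda>i. \<mu> (A i)) sums \<mu> (\<Union>i. A i))"

text \<open>The negative part of a signed measure (its lower variation); the empty set contributes
  the value 0 to the supremum, so truncating at 0 in \<^const>\<open>ennreal\<close> is harmless.\<close>

definition negative_part :: "'a measure \<Rightarrow> ('a set \<Rightarrow> real) \<Rightarrow> 'a set \<Rightarrow> ennreal" where
  "negative_part M \<mu> A = (SUP B \<in> {B \<in> sets M. B \<subseteq> A}. ennreal (- \<mu> B))"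

definition negative_mass :: "'a measure \<Rightarrow> ('a set \<Rightarrow> real) \<Rightarrow> ennreal" where
  "negative_mass M \<mu> = negative_part M \<mu> (space M)"

definition proper_distribution :: "'a measure \<Rightarrow> ('a set \<Rightarrow> real) \<Rightarrow> bool" where
  "proper_distribution M \<mu> \<longleftrightarrow>
     signed_measure M \<mu> \<and> (\<forall>A \<in> sets M. 0 \<le> \<mu> A) \<and> \<mu> (space M) = 1"

definition to_measure :: "'a measure \<Rightarrow> ('a set \<Rightarrow> real) \<Rightarrow> 'a measure" where
  "to_measure M \<mu> = measure_of (space M) (sets M) (\<lambda>A. ennreal (\<mu> A))"

lemma signed_measure_Un:
  assumes "signed_measure M \<mu>" "A \<in> sets M" "B \<in> sets M" "A \<inter> B = {}"
  shows "\<mu> (A \<union> B) = \<mu> A + \<mu> B"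
proof -
  let ?F = "binaryset A B"
  have r: "range ?F \<subseteq> sets M" using assms by (auto simp: range_binaryset_eq)
  have d: "disjoint_family ?F"
    using assms(4) by (auto simp: disjoint_family_on_def binaryset_def)
  have e: "\<mu> {} = 0" using assms(1) by (simp add: signed_measure_def)
  have "(\<lambda>i. \<mu> (?F i)) sums \<mu> (\<Union>i. ?F i)"
    using assms(1) r d unfolding signed_measure_def by blast
  moreover have "(\<lambda>i. \<mu> (?F i)) sums (\<mu> A + \<mu> B)"
    using binaryset_sums[of \<mu> A B] e by simp
  ultimately show ?thesis
    by (metis UN_binaryset_eq sums_unique2)
qed

text \<open>With respect to any Hahn decomposition, \<^const>\<open>negative_part\<close> is the negative part of the
  Jordan decomposition.\<close>

lemma negative_part_Hahn:
  assumes sm: "signed_measure M \<mu>" and N: "N \<in> sets M" and A: "A \<in> sets M"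
    and neg: "\<And>B. B \<in> sets M \<Longrightarrow> B \<subseteq> N \<Longrightarrow> \<mu> B \<le> 0"
    and pos: "\<And>B. B \<in> sets M \<Longrightarrow> B \<inter> N = {} \<Longrightarrow> 0 \<le> \<mu> B"
  shows "negative_part M \<mu> A = ennreal (- \<mu> (A \<inter> N))"
  unfolding negative_part_def
proof (rule antisym)
  show "(SUP B \<in> {B \<in> sets M. B \<subseteq> A}. ennreal (- \<mu> B)) \<le> ennreal (- \<mu> (A \<inter> N))"
  proof (rule SUP_least)
    fix B assume "B \<in> {B \<in> sets M. B \<subseteq> A}"
    then have B: "B \<in> sets M" "B \<subseteq> A" by auto
    have "\<mu> B = \<mu> (B \<inter> N) + \<mu> (B - N)"
      using signed_measure_Un[OF sm, of "B \<inter> N" "B - N"] B N by (simp add: Int_Diff_Un Int_Diff_disjoint)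
    moreover have "0 \<le> \<mu> (B - N)" using pos[of "B - N"] B N by blast
    moreover have "\<mu> (A \<inter> N) = \<mu> (B \<inter> N) + \<mu> (A \<inter> N - B)"
    proof -
      have "A \<inter> N = (B \<inter> N) \<union> (A \<inter> N - B)" using B by blast
      moreover have "(B \<inter> N) \<inter> (A \<inter> N - B) = {}" by blast
      ultimately show ?thesis
        using signed_measure_Un[OF sm, of "B \<inter> N" "A \<inter> N - B"] B N A by simp
    qed
    moreover have "\<mu> (A \<inter> N - B) \<le> 0" using neg[of "A \<inter> N - B"] A B N by blast
    ultimately show "ennreal (- \<mu> B) \<le> ennreal (- \<mu> (A \<inter> N))" by (intro ennreal_leI) linarith
  qed
  show "ennreal (- \<mu> (A \<inter> N)) \<le> (SUP B \<in> {B \<in> sets M. B \<subseteq> A}. ennreal (- \<mu> B))"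
    using A N by (intro SUP_upper) auto
qed

lemma negative_mass_finite:
  fixes q :: "'a \<Rightarrow> real"
  assumes fin: "finite S"
  shows "negative_mass (count_space S) (\<lambda>A. \<Sum>x\<in>A. q x) = ennreal (\<Sum>x\<in>S. max 0 (- q x))"
  unfolding negative_mass_def negative_part_def
proof (rule antisym)
  show "(SUP B \<in> {B \<in> sets (count_space S). B \<subseteq> space (count_space S)}. ennreal (- (\<Sum>x\<in>B. q x)))
      \<le> ennreal (\<Sum>x\<in>S. max 0 (- q x))"
  proof (rule SUP_least, rule ennreal_leI)
    fix B assume "B \<in> {B \<in> sets (count_space S). B \<subseteq> space (count_space S)}"
    then have B: "B \<subseteq> S" by auto
    have "- (\<Sum>x\<in>B. q x) \<le> (\<Sum>x\<in>B. max 0 (- q x))"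
      unfolding sum_negf[symmetric] by (rule sum_mono) simp
    also have "\<dots> \<le> (\<Sum>x\<in>S. max 0 (- q x))"
      using fin B by (intro sum_mono2) auto
    finally show "- (\<Sum>x\<in>B. q x) \<le> (\<Sum>x\<in>S. max 0 (- q x))" .
  qed
  have "(\<Sum>x\<in>S. max 0 (- q x)) = (\<Sum>x\<in>{x \<in> S. q x < 0}. max 0 (- q x))"
    using fin by (intro sum.mono_neutral_right) auto
  also have "\<dots> = (\<Sum>x\<in>{x \<in> S. q x < 0}. - q x)" by (rule sum.cong) auto
  finally have "ennreal (\<Sum>x\<in>S. max 0 (- q x)) = ennreal (- (\<Sum>x\<in>{x \<in> S. q x < 0}. q x))"
    by (simp add: sum_negf)
  then show "ennreal (\<Sum>x\<in>S. max 0 (- q x))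
      \<le> (SUP B \<in> {B \<in> sets (count_space S). B \<subseteq> space (count_space S)}. ennreal (- (\<Sum>x\<in>B. q x)))"
    by (auto intro!: SUP_upper2[of "{x \<in> S. q x < 0}"])
qed

lemma sets_to_measure [simp, measurable_cong]: "sets (to_measure M \<mu>) = sets M"
  by (simp add: to_measure_def)

lemma space_to_measure [simp]: "space (to_measure M \<mu>) = space M"
  by (simp add: to_measure_def)

lemma emeasure_to_measure:
  assumes pr: "proper_distribution M \<mu>" and A: "A \<in> sets M"
  shows "emeasure (to_measure M \<mu>) A = ennreal (\<mu> A)"
  unfolding to_measure_def
proof (rule emeasure_measure_of_sigma)
  show "sigma_algebra (space M) (sets M)" by (rule sets.sigma_algebra_axioms)
  show "positive (sets M) (\<lambda>A. ennreal (\<mu> A))"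
    using pr by (simp add: positive_def proper_distribution_def signed_measure_def)
  show "countably_additive (sets M) (\<lambda>A. ennreal (\<mu> A))"
  proof (rule countably_additiveI)
    fix F :: "nat \<Rightarrow> 'a set"
    assume F: "range F \<subseteq> sets M" "disjoint_family F"
    have "(\<lambda>i. \<mu> (F i)) sums \<mu> (\<Union>i. F i)"
      using pr F by (auto simp: proper_distribution_def signed_measure_def)
    moreover have "0 \<le> \<mu> (F i)" for i
      using pr F by (auto simp: proper_distribution_def)
    ultimately show "(\<Sum>i. ennreal (\<mu> (F i))) = ennreal (\<mu> (\<Union>i. F i))"
      by (simp add: suminf_ennreal2 sums_iff)
  qed
qed (rule A)

text \<open>A coupling of two random variables with laws \<open>M\<close> and \<open>N\<close> is represented by its joint law.\<close>

definition couplings :: "'a measure \<Rightarrow> 'b measure \<Rightarrow> ('a \<times> 'b) measure set" where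
  "couplings M N = {K. prob_space K \<and> sets K = sets (M \<Otimes>\<^sub>M N) \<and>
     distr K M fst = M \<and> distr K N snd = N}"

text \<open>Measurability of the events \<open>{X \<noteq> Y}\<close>. Applied to the two coordinate projections, this
  is measurability of the diagonal, which by the next lemma suffices for all \<open>X\<close> and \<open>Y\<close>.\<close>

definition measurable_neq :: "'e measure \<Rightarrow> bool" where
  "measurable_neq M \<longleftrightarrow> {z \<in> space (M \<Otimes>\<^sub>M M). fst z \<noteq> snd z} \<in> sets (M \<Otimes>\<^sub>M M)"

lemma measurable_neqD:
  assumes "measurable_neq M" "X \<in> measurable L M" "Y \<in> measurable L M"
  shows "{\<omega> \<in> space L. X \<omega> \<noteq> Y \<omega>} \<in> sets L"
proof -
  have m: "(\<lambda>\<omega>. (X \<omega>, Y \<omega>)) \<in> measurable L (M \<Otimes>\<^sub>M M)" using assms(2,3) by simp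
  have "(\<lambda>\<omega>. (X \<omega>, Y \<omega>)) -` {z \<in> space (M \<Otimes>\<^sub>M M). fst z \<noteq> snd z} \<inter> space L
      = {\<omega> \<in> space L. X \<omega> \<noteq> Y \<omega>}"
    using measurable_space[OF assms(2)] measurable_space[OF assms(3)]
    by (auto simp: space_pair_measure)
  then show ?thesis
    using measurable_sets[OF m assms(1)[unfolded measurable_neq_def]] by simp
qed

text \<open>Throughout, \<open>P\<close> is the set of properties, \<open>C\<close> the set of contexts, \<open>Pc c\<close> the set of
  properties entering in context \<open>c\<close>, \<open>E p\<close> the value space of property \<open>p\<close>, \<open>\<Omega> c\<close> the
  probability space of the bunch of context \<open>c\<close>, and \<open>R c p\<close> its member representing \<open>p\<close>.\<close>

definition contexts_of :: "'c set \<Rightarrow> ('c \<Rightarrow> 'p set) \<Rightarrow> 'p \<Rightarrow> 'c set" where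
  "contexts_of C Pc p = {c \<in> C. p \<in> Pc c}"

locale random_system =
  fixes P :: "'p set" and C :: "'c set" and Pc :: "'c \<Rightarrow> 'p set"
    and E :: "'p \<Rightarrow> 'e measure" and \<Omega> :: "'c \<Rightarrow> 'w measure"
    and R :: "'c \<Rightarrow> 'p \<Rightarrow> 'w \<Rightarrow> 'e"
  assumes finite_P: "finite P"
    and finite_C: "finite C"
    and Pc_subset: "\<And>c. c \<in> C \<Longrightarrow> Pc c \<subseteq> P"
    and neq: "\<And>p. p \<in> P \<Longrightarrow> measurable_neq (E p)"
    and prob: "\<And>c. c \<in> C \<Longrightarrow> prob_space (\<Omega> c)"
    and rv: "\<And>c p. c \<in> C \<Longrightarrow> p \<in> Pc c \<Longrightarrow> R c p \<in> measurable (\<Omega> c) (E p)"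

definition consistently_connected ::
  "'p set \<Rightarrow> 'c set \<Rightarrow> ('c \<Rightarrow> 'p set) \<Rightarrow> ('p \<Rightarrow> 'e measure) \<Rightarrow> ('c \<Rightarrow> 'w measure)
    \<Rightarrow> ('c \<Rightarrow> 'p \<Rightarrow> 'w \<Rightarrow> 'e) \<Rightarrow> bool" where
  "consistently_connected P C Pc E \<Omega> R \<longleftrightarrow>
     (\<forall>p\<in>P. \<forall>c\<in>contexts_of C Pc p. \<forall>c'\<in>contexts_of C Pc p.
        distr (\<Omega> c) (E p) (R c p) = distr (\<Omega> c') (E p) (R c' p))"

definition bunch_law ::
  "('c \<Rightarrow> 'p set) \<Rightarrow> ('p \<Rightarrow> 'e measure) \<Rightarrow> ('c \<Rightarrow> 'w measure) \<Rightarrow> ('c \<Rightarrow> 'p \<Rightarrow> 'w \<Rightarrow> 'e)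
    \<Rightarrow> 'c \<Rightarrow> ('p \<Rightarrow> 'e) measure" where
  "bunch_law Pc E \<Omega> R c = distr (\<Omega> c) (PiM (Pc c) E) (\<lambda>\<omega>. \<lambda>p\<in>Pc c. R c p \<omega>)"

definition np_joint :: "'p set \<Rightarrow> ('p \<Rightarrow> 'e measure) \<Rightarrow> (('p \<Rightarrow> 'e) set \<Rightarrow> real) \<Rightarrow> bool" where
  "np_joint P E \<mu> \<longleftrightarrow> signed_measure (PiM P E) \<mu> \<and> \<mu> (space (PiM P E)) = 1"

definition marginal ::
  "'p set \<Rightarrow> ('p \<Rightarrow> 'e measure) \<Rightarrow> (('p \<Rightarrow> 'e) set \<Rightarrow> real) \<Rightarrow> 'p set \<Rightarrow> ('p \<Rightarrow> 'e) set \<Rightarrow> real" where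
  "marginal P E \<mu> J A = \<mu> ((\<lambda>x. restrict x J) -` A \<inter> space (PiM P E))"

text \<open>In context \<open>c\<close>, \<open>K c\<close> is the joint law of the pair of vectors \<open>(r, q)\<close> coupling \<open>(R\<^sup>c, Q\<^sup>c)\<close>.\<close>

definition Delta ::
  "'p set \<Rightarrow> 'c set \<Rightarrow> ('c \<Rightarrow> 'p set) \<Rightarrow> ('c \<Rightarrow> (('p \<Rightarrow> 'e) \<times> ('p \<Rightarrow> 'e)) measure) \<Rightarrow> ennreal" where
  "Delta P C Pc K = (\<Sum>p\<in>P. \<Sum>c\<in>contexts_of C Pc p.
     emeasure (K c) {(r, q) \<in> space (K c). q p \<noteq> r p})"

text \<open>The outer infimum ranges over the laws \<open>Q\<close> of random variables with values in \<open>E p\<close>; minima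
  are read as infima here and below, with value \<open>\<infinity>\<close> over an empty set of competitors.\<close>

definition Delta_min ::
  "'c set \<Rightarrow> ('c \<Rightarrow> 'p set) \<Rightarrow> ('p \<Rightarrow> 'e measure) \<Rightarrow> ('c \<Rightarrow> 'w measure)
    \<Rightarrow> ('c \<Rightarrow> 'p \<Rightarrow> 'w \<Rightarrow> 'e) \<Rightarrow> 'p \<Rightarrow> ennreal" where
  "Delta_min C Pc E \<Omega> R p =
     (INF Q \<in> {Q. prob_space Q \<and> sets Q = sets (E p)}. \<Sum>c\<in>contexts_of C Pc p.
        INF K \<in> couplings Q (distr (\<Omega> c) (E p) (R c p)).
          emeasure K {(t, s) \<in> space K. t \<noteq> s})"

definition Delta_0 ::
  "'p set \<Rightarrow> 'c set \<Rightarrow> ('c \<Rightarrow> 'p set) \<Rightarrow> ('p \<Rightarrow> 'e measure) \<Rightarrow> ('c \<Rightarrow> 'w measure)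
    \<Rightarrow> ('c \<Rightarrow> 'p \<Rightarrow> 'w \<Rightarrow> 'e) \<Rightarrow> ennreal" where
  "Delta_0 P C Pc E \<Omega> R = (\<Sum>p\<in>P. Delta_min C Pc E \<Omega> R p)"

definition coupled_np_measure ::
  "'p set \<Rightarrow> 'c set \<Rightarrow> ('c \<Rightarrow> 'p set) \<Rightarrow> ('p \<Rightarrow> 'e measure) \<Rightarrow> ('c \<Rightarrow> 'w measure)
    \<Rightarrow> ('c \<Rightarrow> 'p \<Rightarrow> 'w \<Rightarrow> 'e) \<Rightarrow> ennreal" where
  "coupled_np_measure P C Pc E \<Omega> R = (INF \<mu> \<in> {\<mu>. np_joint P E \<mu> \<and>
       (\<forall>c\<in>C. proper_distribution (PiM (Pc c) E) (marginal P E \<mu> (Pc c))) \<and>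
       (\<exists>K. (\<forall>c\<in>C. K c \<in> couplings (bunch_law Pc E \<Omega> R c)
                              (to_measure (PiM (Pc c) E) (marginal P E \<mu> (Pc c)))) \<and>
            Delta P C Pc K = Delta_0 P C Pc E \<Omega> R)}.
     negative_mass (PiM P E) \<mu>)"

definition np_measure ::
  "'p set \<Rightarrow> 'c set \<Rightarrow> ('c \<Rightarrow> 'p set) \<Rightarrow> ('p \<Rightarrow> 'e measure) \<Rightarrow> ('c \<Rightarrow> 'w measure)
    \<Rightarrow> ('c \<Rightarrow> 'p \<Rightarrow> 'w \<Rightarrow> 'e) \<Rightarrow> ennreal" where
  "np_measure P C Pc E \<Omega> R = (INF \<mu> \<in> {\<mu>. np_joint P E \<mu> \<and>
       (\<forall>c\<in>C. \<forall>A\<in>sets (PiM (Pc c) E).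
          marginal P E \<mu> (Pc c) A = measure (bunch_law Pc E \<Omega> R c) A)}.
     negative_mass (PiM P E) \<mu>)"

end

theory Submission
  imports Defs
begin

text \<open>Consistent connectedness gives \<open>\<Delta>\<^sub>0 = 0\<close>: the common law of the \<open>R\<^sup>c\<^sub>p\<close> is coupled
  diagonally with each of them. Hence \<open>\<Delta> = \<Delta>\<^sub>0\<close> says that in every context the coupled bunches
  agree almost surely, which forces \<open>Q\<^sup>c \<sim> R\<^sup>c\<close>; conversely, if \<open>Q\<^sup>c \<sim> R\<^sup>c\<close>, the diagonal couplings
  have \<open>\<Delta> = 0\<close>. So the two minima range over the same joints. The one exception is a property
  that has an empty value space and enters in no context: then \<open>\<Delta>\<^sub>0 = \<infinity>\<close>, but no joint exists
  either.\<close>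

definition diagonal_coupling :: "'a measure \<Rightarrow> ('a \<times> 'a) measure" where
  "diagonal_coupling M = distr M (M \<Otimes>\<^sub>M M) (\<lambda>x. (x, x))"

lemma space_diagonal_coupling [simp]: "space (diagonal_coupling M) = space M \<times> space M"
  by (simp add: diagonal_coupling_def space_pair_measure)

lemma diagonal_coupling_in_couplings:
  assumes "prob_space M"
  shows "diagonal_coupling M \<in> couplings M M"
proof -
  interpret prob_space M by fact
  have "prob_space (diagonal_coupling M)"
    unfolding diagonal_coupling_def by (intro prob_space_distr) simp
  moreover have "distr (diagonal_coupling M) M fst = M" "distr (diagonal_coupling M) M snd = M"
    by (simp_all add: diagonal_coupling_def distr_distr comp_def distr_id2)
  ultimately show ?thesis
    by (simp add: couplings_def) (simp add: diagonal_coupling_def)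
qed

text \<open>For a nonmeasurable \<open>A\<close> this holds because its \<^const>\<open>emeasure\<close> is 0 by convention.\<close>

lemma emeasure_diagonal_coupling_eq_0:
  assumes "\<And>x. x \<in> space M \<Longrightarrow> (x, x) \<notin> A"
  shows "emeasure (diagonal_coupling M) A = 0"
proof (cases "A \<in> sets (M \<Otimes>\<^sub>M M)")
  case True
  have "(\<lambda>x. (x, x)) -` A \<inter> space M = {}" using assms by auto
  with True show ?thesis by (simp add: diagonal_coupling_def emeasure_distr)
next
  case False
  then show ?thesis by (intro emeasure_notin_sets) (simp add: diagonal_coupling_def)
qed

text \<open>Both laws are images of the single measure \<open>K\<close>, under two projections that
  agree outside a null set. Since \<open>M\<close> and \<open>N\<close> carry the same
  sigma-algebra, both images can be taken in the same target space and compared.\<close>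

lemma coupling_AE_eq_imp_eq:
  assumes K: "K \<in> couplings M N" and sets: "sets M = sets N"
    and eq: "AE z in K. fst z = snd z"
  shows "M = N"
proof -
  have setsK: "sets K = sets (M \<Otimes>\<^sub>M N)" and M: "distr K M fst = M" and N: "distr K N snd = N"
    using K by (auto simp: couplings_def)
  have [measurable]: "fst \<in> measurable K M" "snd \<in> measurable K N"
    by (simp_all add: measurable_cong_sets[OF setsK refl])
  have [measurable]: "snd \<in> measurable K M"
    by (simp add: measurable_cong_sets[OF refl sets])
  have "M = distr K M fst" by (simp add: M)
  also have "\<dots> = distr K M snd" by (rule distr_cong_AE) (use eq in simp_all)
  also have "\<dots> = distr K N snd" by (rule distr_cong) (simp_all add: sets)
  finally show ?thesis by (simp add: N)
qed

context random_system
begin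

lemma finite_Pc: "c \<in> C \<Longrightarrow> finite (Pc c)"
  using finite_P Pc_subset finite_subset by blast

lemma contexts_of_iff: "c \<in> contexts_of C Pc p \<longleftrightarrow> c \<in> C \<and> p \<in> Pc c"
  by (simp add: contexts_of_def)

lemma finite_contexts_of [simp]: "finite (contexts_of C Pc p)"
  using finite_C by (simp add: contexts_of_def)

lemma sets_bunch_law [simp, measurable_cong]:
  "sets (bunch_law Pc E \<Omega> R c) = sets (PiM (Pc c) E)"
  by (simp add: bunch_law_def)

lemma space_bunch_law [simp]: "space (bunch_law Pc E \<Omega> R c) = space (PiM (Pc c) E)"
  by (simp add: bunch_law_def)

lemma prob_space_bunch_law:
  assumes c: "c \<in> C"
  shows "prob_space (bunch_law Pc E \<Omega> R c)"
proof -
  interpret prob_space "\<Omega> c" using prob c .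
  have "(\<lambda>\<omega>. \<lambda>p\<in>Pc c. R c p \<omega>) \<in> measurable (\<Omega> c) (PiM (Pc c) E)"
    using rv[OF c] by (intro measurable_restrict)
  then show ?thesis unfolding bunch_law_def by (rule prob_space_distr)
qed

lemma Delta_min_eq_0:
  assumes cc: "consistently_connected P C Pc E \<Omega> R" and p: "p \<in> P" and ne: "space (E p) \<noteq> {}"
  shows "Delta_min C Pc E \<Omega> R p = 0"
proof -
  define L where "L c = distr (\<Omega> c) (E p) (R c p)" for c
  obtain Q where Q: "prob_space Q" "sets Q = sets (E p)" and QL: "\<forall>c\<in>contexts_of C Pc p. L c = Q"
  proof (cases "contexts_of C Pc p = {}")
    case True
    obtain x where "x \<in> space (E p)" using ne by blast
    \<comment> \<open>With no contexts the inner sum is empty for every \<open>Q\<close>, so any law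
      will do. The point mass only ensures that the infimum does not range over the empty set, where
      it would be infinite.\<close>
    then show ?thesis using True that[of "return (E p) x"] by (simp add: prob_space_return)
  next
    case False
    then obtain c where c: "c \<in> contexts_of C Pc p" by blast
    then have "prob_space (L c)"
      unfolding L_def contexts_of_iff using rv prob by (intro prob_space.prob_space_distr) auto
    moreover have "\<forall>c'\<in>contexts_of C Pc p. L c' = L c"
      using cc p c unfolding consistently_connected_def L_def by blast
    moreover have "sets (L c) = sets (E p)" by (simp add: L_def)
    ultimately show ?thesis using that by blast
  qed
  have "(INF K \<in> couplings Q (L c). emeasure K {(t, s) \<in> space K. t \<noteq> s}) = 0"
    if "c \<in> contexts_of C Pc p" for c
  proof -
    have "diagonal_coupling Q \<in> couplings Q (L c)"
      using QL that diagonal_coupling_in_couplings[OF Q(1)] by simp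
    then have "(INF K \<in> couplings Q (L c). emeasure K {(t, s) \<in> space K. t \<noteq> s})
        \<le> emeasure (diagonal_coupling Q) {(t, s) \<in> space (diagonal_coupling Q). t \<noteq> s}"
      by (rule INF_lower)
    also have "\<dots> = 0" by (rule emeasure_diagonal_coupling_eq_0) simp
    finally show ?thesis by simp
  qed
  then have "(\<Sum>c\<in>contexts_of C Pc p. INF K \<in> couplings Q (distr (\<Omega> c) (E p) (R c p)).
      emeasure K {(t, s) \<in> space K. t \<noteq> s}) = 0"
    by (simp add: L_def)
  then have "Delta_min C Pc E \<Omega> R p \<le> 0"
    unfolding Delta_min_def using Q by (intro INF_lower2[of Q]) auto
  then show ?thesis by simp
qed

lemma Delta_0_eq_0:
  assumes "consistently_connected P C Pc E \<Omega> R" and "space (PiM P E) \<noteq> {}"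
  shows "Delta_0 P C Pc E \<Omega> R = 0"
proof -
  have "space (E p) \<noteq> {}" if "p \<in> P" for p
    using assms(2) that by (auto simp: space_PiM PiE_eq_empty_iff)
  then show ?thesis unfolding Delta_0_def using Delta_min_eq_0[OF assms(1)] by simp
qed

lemma Delta_diagonal_coupling:
  "Delta P C Pc (\<lambda>c. diagonal_coupling (bunch_law Pc E \<Omega> R c)) = 0"
  unfolding Delta_def by (intro sum.neutral ballI emeasure_diagonal_coupling_eq_0) simp

text \<open>A vanishing finite sum of nonnegative terms has only zero terms, so each coordinate of
  the two coupled vectors agrees almost surely. As there are finitely many coordinates, the vectors
  agree almost surely.\<close>

lemma Delta_eq_0_imp_bunch_law_eq:
  assumes K: "\<And>c. c \<in> C \<Longrightarrow> K c \<in> couplings (bunch_law Pc E \<Omega> R c) (N c)"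
    and N: "\<And>c. c \<in> C \<Longrightarrow> sets (N c) = sets (PiM (Pc c) E)"
    and Delta: "Delta P C Pc K = 0" and c: "c \<in> C"
  shows "bunch_law Pc E \<Omega> R c = N c"
proof (rule coupling_AE_eq_imp_eq[OF K[OF c]])
  show "sets (bunch_law Pc E \<Omega> R c) = sets (N c)" using N[OF c] by simp
  have setsK: "sets (K c) = sets (PiM (Pc c) E \<Otimes>\<^sub>M PiM (Pc c) E)"
    using K[OF c] N[OF c] by (simp add: couplings_def cong: sets_pair_measure_cong)
  note spaceK = sets_eq_imp_space_eq[OF setsK]
  have "AE z in K c. fst z p = snd z p" if p: "p \<in> Pc c" for p
  proof -
    have pP: "p \<in> P" using Pc_subset c p by blast
    have [measurable]: "fst \<in> measurable (K c) (PiM (Pc c) E)" "snd \<in> measurable (K c) (PiM (Pc c) E)"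
      by (simp_all add: measurable_cong_sets[OF setsK refl])
    have "(\<lambda>z. snd z p) \<in> measurable (K c) (E p)" "(\<lambda>z. fst z p) \<in> measurable (K c) (E p)"
      using p by measurable
    \<comment> \<open>Measurability of the event matters here: \<open>emeasure\<close> is 0 by
      default on a nonmeasurable set, so the value 0 alone would not give a null set.\<close>
    from measurable_neqD[OF neq[OF pP] this]
    have "{z \<in> space (K c). snd z p \<noteq> fst z p} \<in> sets (K c)" .
    moreover have "{z \<in> space (K c). snd z p \<noteq> fst z p} = {(r, q) \<in> space (K c). q p \<noteq> r p}"
      by auto
    then have "emeasure (K c) {z \<in> space (K c). snd z p \<noteq> fst z p} = 0"
      using Delta pP c p finite_P by (simp add: Delta_def contexts_of_iff)
    ultimately show ?thesis by (intro AE_I) auto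
  qed
  then have "AE z in K c. \<forall>p\<in>Pc c. fst z p = snd z p"
    using finite_Pc[OF c] by (simp add: AE_finite_all)
  then show "AE z in K c. fst z = snd z"
  proof (rule AE_mp, intro AE_I2 impI)
    \<comment> \<open>Points of the product space are extensional functions on \<open>Pc c\<close>,
      so agreement on \<open>Pc c\<close> is equality.\<close>
    fix z assume "z \<in> space (K c)" and eq: "\<forall>p\<in>Pc c. fst z p = snd z p"
    then have "fst z \<in> Pi\<^sub>E (Pc c) (\<lambda>p. space (E p))" "snd z \<in> Pi\<^sub>E (Pc c) (\<lambda>p. space (E p))"
      by (auto simp: spaceK space_pair_measure space_PiM)
    then show "fst z = snd z" using eq by (intro PiE_ext) auto
  qed
qed

text \<open>Compares the constraints of the two minimization problems one joint at a time.\<close>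

lemma coupled_iff_marginals_agree:
  assumes cc: "consistently_connected P C Pc E \<Omega> R" and joint: "np_joint P E \<mu>"
  shows "(\<forall>c\<in>C. proper_distribution (PiM (Pc c) E) (marginal P E \<mu> (Pc c))) \<and>
       (\<exists>K. (\<forall>c\<in>C. K c \<in> couplings (bunch_law Pc E \<Omega> R c)
                              (to_measure (PiM (Pc c) E) (marginal P E \<mu> (Pc c)))) \<and>
            Delta P C Pc K = Delta_0 P C Pc E \<Omega> R) \<longleftrightarrow>
     (\<forall>c\<in>C. \<forall>A\<in>sets (PiM (Pc c) E).
        marginal P E \<mu> (Pc c) A = measure (bunch_law Pc E \<Omega> R c) A)"
    (is "(\<forall>c\<in>C. ?proper c) \<and> (\<exists>K. ?coupled K) \<longleftrightarrow> ?agree")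
proof -
  have "\<mu> {} = 0" "\<mu> (space (PiM P E)) = 1"
    using joint by (auto simp: np_joint_def signed_measure_def)
  \<comment> \<open>Total mass 1 rules out an empty product, and with it the case of infinite
    \<open>Delta_0\<close>.\<close>
  then have "space (PiM P E) \<noteq> {}" by (metis zero_neq_one)
  note D0 = Delta_0_eq_0[OF cc this]
  show ?thesis
  proof (intro iffI conjI; (elim conjE exE)?)
    fix K
    assume pr: "\<forall>c\<in>C. ?proper c"
      and K: "\<forall>c\<in>C. K c \<in> couplings (bunch_law Pc E \<Omega> R c)
                              (to_measure (PiM (Pc c) E) (marginal P E \<mu> (Pc c)))"
      and D: "Delta P C Pc K = Delta_0 P C Pc E \<Omega> R"
    show ?agree
    proof (intro ballI)
      fix c A assume c: "c \<in> C" and A: "A \<in> sets (PiM (Pc c) E)"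
      have "bunch_law Pc E \<Omega> R c = to_measure (PiM (Pc c) E) (marginal P E \<mu> (Pc c))"
        using K D D0 c by (intro Delta_eq_0_imp_bunch_law_eq[where K = K]) auto
      then have "emeasure (bunch_law Pc E \<Omega> R c) A = ennreal (marginal P E \<mu> (Pc c) A)"
        using pr c A by (simp add: emeasure_to_measure)
      \<comment> \<open>\<open>ennreal\<close> truncates negative reals to 0, so the sign is needed
        to pass back to real values.\<close>
      moreover have "0 \<le> marginal P E \<mu> (Pc c) A"
        using pr c A by (simp add: proper_distribution_def)
      ultimately show "marginal P E \<mu> (Pc c) A = measure (bunch_law Pc E \<Omega> R c) A"
        by (simp add: measure_def)
    qed
  next
    assume agree: ?agree
    show proper: "\<forall>c\<in>C. ?proper c"
    proof
      fix c assume c: "c \<in> C"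
      interpret B: prob_space "bunch_law Pc E \<Omega> R c" using prob_space_bunch_law[OF c] .
      have eq: "marginal P E \<mu> (Pc c) A = B.prob A" if "A \<in> sets (PiM (Pc c) E)" for A
        using agree c that by blast
      \<comment> \<open>Countable additivity is inherited from the bunch law, with which the
        marginal agrees on each \<open>A i\<close> and on their union.\<close>
      have "(\<lambda>i. marginal P E \<mu> (Pc c) (A i)) sums marginal P E \<mu> (Pc c) (\<Union>i. A i)"
        if A: "range A \<subseteq> sets (PiM (Pc c) E)" "disjoint_family A" for A :: "nat \<Rightarrow> _"
      proof -
        have "A i \<in> sets (PiM (Pc c) E)" for i using A by blast
        then show ?thesis
          using B.finite_measure_UNION[of A] A by (simp add: eq sets.countable_UN)
      qed
      moreover have "B.prob (space (PiM (Pc c) E)) = 1"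
        using B.prob_space by simp
      ultimately show "?proper c"
        by (simp add: proper_distribution_def signed_measure_def eq)
    qed
    show "\<exists>K. ?coupled K"
    proof (intro exI conjI ballI)
      fix c assume c: "c \<in> C"
      interpret B: prob_space "bunch_law Pc E \<Omega> R c" using prob_space_bunch_law[OF c] .
      have "to_measure (PiM (Pc c) E) (marginal P E \<mu> (Pc c)) = bunch_law Pc E \<Omega> R c"
        using proper agree c by (intro measure_eqI) (auto simp: emeasure_to_measure B.emeasure_eq_measure)
      then show "diagonal_coupling (bunch_law Pc E \<Omega> R c)
          \<in> couplings (bunch_law Pc E \<Omega> R c) (to_measure (PiM (Pc c) E) (marginal P E \<mu> (Pc c)))"
        using diagonal_coupling_in_couplings[OF B.prob_space_axioms] by simp
    qed (simp add: Delta_diagonal_coupling D0)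
  qed
qed

end

theorem theorem14:
  fixes P :: "'p set" and C :: "'c set" and Pc :: "'c \<Rightarrow> 'p set"
    and E :: "'p \<Rightarrow> 'e measure" and \<Omega> :: "'c \<Rightarrow> 'w measure"
    and R :: "'c \<Rightarrow> 'p \<Rightarrow> 'w \<Rightarrow> 'e"
  assumes "random_system P C Pc E \<Omega> R"
    and "consistently_connected P C Pc E \<Omega> R"
  shows "coupled_np_measure P C Pc E \<Omega> R = np_measure P C Pc E \<Omega> R"
proof -
  interpret random_system P C Pc E \<Omega> R by fact
  show ?thesis
    unfolding coupled_np_measure_def np_measure_def
    \<comment> \<open>The objectives are identical; \<open>conj_cong\<close> makes
      \<open>np_joint\<close> available as a hypothesis when the remaining constraints are
      compared.\<close>
    by (intro INF_cong Collect_cong conj_cong refl coupled_iff_marginals_agree[OF assms(2)])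
qed

end
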